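(* Let $s$ and $k$ be any positive integers, and let $\mathcal F$ be a family of (distinct) subsets of a universal set $X$, each of cardinality at most $s$. If $$|\mathcal F|\ \ge\ \left(\sqrt{10}-2\right)^2\left(\frac{k}{\sqrt{10}-2}\right)^s s!,$$ then $\mathcal F$ includes a $k$-sunflower, i.e. there is a sub-family $\mathcal B\subset\mathcal F$ that is a sunflower of cardinality $k$.
   Context: A family $\mathcal B$ of sets is a sunflower with a core $Y$ if $U\cap U'=Y$ for every two different elements $U,U'\in\mathcal B$; equivalently, $U\cap U'=\bigcap_{V\in\mathcal B}V$ for all $U\neq U'$ in $\mathcal B$. The core may be empty. A $k$-sunflower is a sunflower of cardinality $k$, i.e. consisting of exactly $k$ distinct sets (for $k=1$, any single set). *)

theory Defs
  imports Complex_Main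
begin

definition sunflower_with_core :: "'a set set \<Rightarrow> 'a set \<Rightarrow> bool" where
  "sunflower_with_core B Y \<longleftrightarrow> pairwise (\<lambda>U U'. U \<inter> U' = Y) B"

definition sunflower :: "'a set set \<Rightarrow> bool" where
  "sunflower B \<longleftrightarrow> (\<exists>Y. sunflower_with_core B Y)"

definition k_sunflower :: "nat \<Rightarrow> 'a set set \<Rightarrow> bool" where
  "k_sunflower k B \<longleftrightarrow> sunflower B \<and> finite B \<and> card B = k"

text \<open>\<^term>\<open>card\<close> is 0 on infinite sets, so cardinality comparisons carry the
  (in)finiteness explicitly: an infinite family exceeds every real bound.\<close>

definition card_at_most :: "'a set \<Rightarrow> nat \<Rightarrow> bool" where
  "card_at_most U s \<longleftrightarrow> finite U \<and> card U \<le> s"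

definition card_at_least :: "'a set \<Rightarrow> real \<Rightarrow> bool" where
  "card_at_least F r \<longleftrightarrow> infinite F \<or> real (card F) \<ge> r"

end

(* Take a maximum pairwise disjoint subfamily B of a family F without k-sunflower, so B has fewer than
   k members, and let V be its union. Counting incidences between F and V bounds the sets of F by the
   degrees of the points of V, and sets meeting V in two or more points are counted at least twice.
   The sets meeting V in a single point, which belongs to a given A in B, are pairwise intersecting,
   for otherwise two of them could replace A in B. Hence, up to one star, each of them contains
   a pair of points from a fixed collection of at most (s-1)^2 pairs, so they are few. Induction on s
   bounds the degrees of points and pairs, and the worst case k = 2, s = 3 of the resulting
   recursion leads to c^2 + 4c = 6, that is c = sqrt 10 - 2. *)
theory Submission imports Defs begin

section \<open>Sunflower-free families and their links\<close>

definition sunflower_free :: "nat \<Rightarrow> 'a set set \<Rightarrow> bool" where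
  "sunflower_free k F \<longleftrightarrow> \<not> (\<exists>B \<subseteq> F. k_sunflower k B)"

text \<open>Finiteness is built in because \<open>card\<close> is 0 on infinite families, where an
  upper bound on it would say nothing.\<close>

definition bounded_family :: "nat \<Rightarrow> 'a set set \<Rightarrow> bool" where
  "bounded_family s F \<longleftrightarrow> finite F \<and> (\<forall>U\<in>F. card_at_most U s)"

text \<open>Adding \<open>T\<close> back to every member of a sunflower with core \<open>Y\<close>
  in the link gives a sunflower with core \<open>Y \<union> T\<close> in \<open>F\<close>. Members
  of the link avoid \<open>T\<close>, so distinct ones stay distinct and the cardinality is
  kept.\<close>

lemma sunflower_free_link:
  assumes "sunflower_free k F"
  shows "sunflower_free k ((\<lambda>U. U - T) ` {U \<in> F. T \<subseteq> U})"
  unfolding sunflower_free_def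
proof
  assume "\<exists>B \<subseteq> (\<lambda>U. U - T) ` {U \<in> F. T \<subseteq> U}. k_sunflower k B"
  then obtain B where B: "B \<subseteq> (\<lambda>U. U - T) ` {U \<in> F. T \<subseteq> U}" "k_sunflower k B" by blast
  then obtain Y where Y: "pairwise (\<lambda>U U'. U \<inter> U' = Y) B" and fin: "finite B" "card B = k"
    unfolding k_sunflower_def sunflower_def sunflower_with_core_def by blast
  have disj: "W \<inter> T = {}" and mem: "W \<union> T \<in> F" if "W \<in> B" for W
    using B(1) that by (auto simp: Un_absorb2)
  have inj: "inj_on (\<lambda>W. W \<union> T) B"
    by (rule inj_onI) (use disj in blast)
  have "pairwise (\<lambda>U U'. U \<inter> U' = Y \<union> T) ((\<lambda>W. W \<union> T) ` B)"
    using Y unfolding pairwise_def by (auto simp flip: Un_Int_distrib2)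
  then have "k_sunflower k ((\<lambda>W. W \<union> T) ` B)"
    unfolding k_sunflower_def sunflower_def sunflower_with_core_def
    using fin card_image[OF inj] by blast
  moreover have "(\<lambda>W. W \<union> T) ` B \<subseteq> F" using mem by (rule image_subsetI)
  ultimately show False using assms unfolding sunflower_free_def by blast
qed

text \<open>This is how induction on \<open>s\<close> controls degrees: removing \<open>T\<close> is
  injective on the sets containing \<open>T\<close>, so their number is the size of a sunflower-free
  link with smaller sets.\<close>

lemma card_containing_le:
  fixes F :: "'a set set" and d :: real
  assumes F: "bounded_family s F" "sunflower_free k F" and T: "finite T"
    and bound: "\<And>G :: 'a set set. bounded_family (s - card T) G \<Longrightarrow> sunflower_free k G \<Longrightarrow> real (card G) \<le> d"
  shows "real (card {U \<in> F. T \<subseteq> U}) \<le> d"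
proof -
  let ?G = "(\<lambda>U. U - T) ` {U \<in> F. T \<subseteq> U}"
  have "inj_on (\<lambda>U. U - T) {U \<in> F. T \<subseteq> U}"
    by (rule inj_onI) blast
  then have "card {U \<in> F. T \<subseteq> U} = card ?G" by (simp add: card_image)
  moreover have "bounded_family (s - card T) ?G"
    using F(1) T unfolding bounded_family_def card_at_most_def
    by (auto simp: card_Diff_subset diff_le_mono)
  ultimately show ?thesis
    using bound[OF _ sunflower_free_link[OF F(2)]] by simp
qed

section \<open>Disjoint subfamilies\<close>

lemma card_disjoint_subfamily_less:
  assumes "sunflower_free k F" "B \<subseteq> F" "pairwise disjnt B"
  shows "card B < k"
proof (rule ccontr)
  assume "\<not> card B < k"
  then obtain C where C: "C \<subseteq> B" "card C = k" "finite C"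
    using obtain_subset_with_card_n[of k B] by auto
  \<comment> \<open>Disjoint sets form a sunflower with empty core.\<close>
  then have "pairwise (\<lambda>U U'. U \<inter> U' = {}) C"
    using assms(3) unfolding pairwise_def disjnt_def by blast
  then have "k_sunflower k C"
    using C unfolding k_sunflower_def sunflower_def sunflower_with_core_def by blast
  then show False using assms C unfolding sunflower_free_def by blast
qed

text \<open>The subfamily is maximum in cardinality, not merely maximal under inclusion: the later
  exchange removes one member and inserts two.\<close>

lemma ex_maximum_disjoint_subfamily:
  fixes F :: "'a set set"
  assumes "finite F"
  obtains B where "B \<subseteq> F" "pairwise disjnt B"
    "\<And>C. C \<subseteq> F \<Longrightarrow> pairwise disjnt C \<Longrightarrow> card C \<le> card B"
proof -
  have "\<exists>B. (B \<subseteq> F \<and> pairwise disjnt B) \<and> (\<forall>C. C \<subseteq> F \<and> pairwise disjnt C \<longrightarrow> card C \<le> card B)"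
  proof (rule ex_has_greatest_nat)
    show "{} \<subseteq> F \<and> pairwise disjnt ({} :: 'a set set)" by simp
    show "\<forall>C. C \<subseteq> F \<and> pairwise disjnt C \<longrightarrow> card C < Suc (card F)"
      using assms by (simp add: card_mono less_Suc_eq_le)
  qed
  then show thesis using that by blast
qed

section \<open>Incidence counting, the exchange argument and the recursion\<close>

lemma sum_card_Int_eq_sum_degree:
  assumes "finite F" "finite V"
  shows "(\<Sum>U\<in>F. card (U \<inter> V)) = (\<Sum>v\<in>V. card {U \<in> F. {v} \<subseteq> U})"
proof -
  have "(\<Sum>U\<in>F. card (U \<inter> V)) = (\<Sum>U\<in>F. \<Sum>v\<in>V. if v \<in> U then 1 else 0)"
    using assms by (intro sum.cong) (auto simp: Int_commute simp flip: sum.inter_restrict)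
  also have "\<dots> = (\<Sum>v\<in>V. \<Sum>U\<in>F. if v \<in> U then 1 else 0)"
    by (rule sum.swap)
  also have "\<dots> = (\<Sum>v\<in>V. card {U \<in> F. {v} \<subseteq> U})"
    using assms by (intro sum.cong) (auto simp flip: sum.inter_filter)
  finally show ?thesis .
qed

text \<open>Fix \<open>U0\<close> in \<open>S\<close>, meeting \<open>V\<close> in
  \<open>v0\<close>. The members of \<open>S\<close> through \<open>v0\<close> form a star of size
  at most \<open>d1\<close>. Any other member contains a point of \<open>A - {v0}\<close> and a
  point of \<open>U0 - {v0}\<close>, which leaves at most \<open>(s - 1)\<^sup>2\<close> pairs, each
  of degree at most \<open>d2\<close>.\<close>

lemma card_intersecting_private_le:
  fixes d1 d2 :: real
  assumes F: "bounded_family s F" and s: "s \<ge> 1" and "A \<in> F"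
    and d1: "d1 \<ge> 0" "\<And>v. real (card {U \<in> F. {v} \<subseteq> U}) \<le> d1"
    and d2: "d2 \<ge> 0" "\<And>v w. v \<noteq> w \<Longrightarrow> real (card {U \<in> F. {v, w} \<subseteq> U}) \<le> d2"
    and S: "S \<subseteq> F" "\<And>U. U \<in> S \<Longrightarrow> \<exists>v\<in>A. U \<inter> V = {v}"
    and "A \<subseteq> V"
    and int: "\<And>U U'. U \<in> S \<Longrightarrow> U' \<in> S \<Longrightarrow> U \<inter> U' \<noteq> {}"
  shows "real (card S) \<le> d1 + (real s - 1)\<^sup>2 * d2"
proof (cases "S = {}")
  case True
  then show ?thesis using d1(1) d2(1) by simp
next
  case False
  then obtain U0 where U0: "U0 \<in> S" by blast
  then obtain v0 where v0: "v0 \<in> A" "U0 \<inter> V = {v0}" using S by blast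
  have fin: "finite F" and A: "finite A" "card A \<le> s" and U0f: "finite U0" "card U0 \<le> s"
    using F \<open>A \<in> F\<close> U0 S(1) unfolding bounded_family_def card_at_most_def by auto
  let ?P = "(A - {v0}) \<times> (U0 - {v0})"
  let ?D = "\<lambda>p. {U \<in> F. {fst p, snd p} \<subseteq> U}"
  have "S \<subseteq> {U \<in> F. {v0} \<subseteq> U} \<union> (\<Union>p\<in>?P. ?D p)"
  proof
    fix U assume U: "U \<in> S"
    then obtain v where v: "v \<in> A" "U \<inter> V = {v}" using S by blast
    obtain y where y: "y \<in> U" "y \<in> U0" using int[OF U U0] by blast
    show "U \<in> {U \<in> F. {v0} \<subseteq> U} \<union> (\<Union>p\<in>?P. ?D p)"
    proof (cases "v0 \<in> U")
      case True
      then show ?thesis using U S(1) by blast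
    next
      case False
      \<comment> \<open>Both \<open>v\<close> and \<open>y\<close> lie in \<open>U\<close>, which
        misses \<open>v0\<close>, so neither equals \<open>v0\<close>.\<close>
      then have "(v, y) \<in> ?P" "U \<in> ?D (v, y)" using v y U S(1) by auto
      then show ?thesis by blast
    qed
  qed
  then have "card S \<le> card ({U \<in> F. {v0} \<subseteq> U} \<union> (\<Union>p\<in>?P. ?D p))"
    using fin A U0f by (intro card_mono) auto
  also have "\<dots> \<le> card {U \<in> F. {v0} \<subseteq> U} + card (\<Union>p\<in>?P. ?D p)"
    by (rule card_Un_le)
  also have "card (\<Union>p\<in>?P. ?D p) \<le> (\<Sum>p\<in>?P. card (?D p))"
    using A U0f by (intro card_UN_le) auto
  finally have "real (card S) \<le> real (card {U \<in> F. {v0} \<subseteq> U}) + (\<Sum>p\<in>?P. real (card (?D p)))"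
    by (simp flip: of_nat_sum of_nat_add del: insert_subset)
  also have "(\<Sum>p\<in>?P. real (card (?D p))) \<le> (\<Sum>p\<in>?P. d2)"
  proof (rule sum_mono)
    fix p assume "p \<in> ?P"
    \<comment> \<open>The first component lies in \<open>V\<close>, the second outside it, since
      \<open>U0\<close> meets \<open>V\<close> only in \<open>v0\<close>.\<close>
    then have "fst p \<noteq> snd p" using v0 \<open>A \<subseteq> V\<close> by auto
    then show "real (card (?D p)) \<le> d2" by (rule d2(2))
  qed
  also have "(\<Sum>p\<in>?P. d2) \<le> (real s - 1)\<^sup>2 * d2"
  proof -
    have "v0 \<in> U0" using v0 by blast
    then have "card (A - {v0}) \<le> s - 1" "card (U0 - {v0}) \<le> s - 1"
      using A U0f v0(1) by (auto simp: card_Diff_singleton)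
    then have "card ?P \<le> (s - 1) * (s - 1)"
      by (simp add: card_cartesian_product mult_le_mono)
    then have "real (card ?P) \<le> real ((s - 1) * (s - 1))"
      by (rule of_nat_mono)
    then have "real (card ?P) \<le> (real s - 1)\<^sup>2"
      using s by (simp add: power2_eq_square of_nat_diff)
    then show ?thesis using d2(1) by (simp add: mult_right_mono)
  qed
  finally show ?thesis using d1(2)[of v0] by linarith
qed

text \<open>If \<open>U\<close> and \<open>U'\<close> were disjoint, exchanging \<open>A\<close> for
  both would give a larger disjoint subfamily: their only points in \<open>\<Union>B\<close> lie in
  \<open>A\<close>, so they miss all other members of \<open>B\<close>.\<close>

lemma intersecting_private_sets:
  assumes B: "B \<subseteq> F" "finite B" "pairwise disjnt B"
    and max: "\<And>C. C \<subseteq> F \<Longrightarrow> pairwise disjnt C \<Longrightarrow> card C \<le> card B"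
    and A: "A \<in> B"
    and U: "U \<in> F" "v \<in> A" "U \<inter> \<Union>B = {v}"
    and U': "U' \<in> F" "v' \<in> A" "U' \<inter> \<Union>B = {v'}"
  shows "U \<inter> U' \<noteq> {}"
proof
  assume UU': "U \<inter> U' = {}"
  let ?C = "insert U (insert U' (B - {A}))"
  have disj: "W \<inter> A = {}" if "W \<in> B - {A}" for W
    using that B(3) A unfolding pairwise_def disjnt_def by blast
  have dU: "U \<inter> W = {}" and dU': "U' \<inter> W = {}" if "W \<in> B - {A}" for W
    using that disj[OF that] U U' by auto
  have "pairwise disjnt ?C"
    using B(3) UU' dU dU' unfolding pairwise_def disjnt_def by (simp add: Int_commute)
  then have "card ?C \<le> card B" using U U' B by (intro max) auto
  \<comment> \<open>Both sets are nonempty, so disjointness from \<open>U'\<close> and from the rest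
    of \<open>B\<close> makes them genuinely new members.\<close>
  moreover have "U \<notin> insert U' (B - {A})" "U' \<notin> B - {A}"
    using UU' dU[of U] dU'[of U'] U(3) U'(3) by auto
  then have "card ?C = Suc (Suc (card (B - {A})))"
    using B(2) by simp
  moreover have "Suc (card (B - {A})) = card B" by (rule card_Suc_Diff1[OF B(2) A])
  ultimately show False by simp
qed

text \<open>Each nonempty member of the maximum disjoint subfamily pays \<open>s * d1\<close> for
  the degrees of its points, and \<open>d1 + (s - 1)\<^sup>2 * d2\<close> for the sets meeting the
  union in one point only, that point lying in it. Hypothesis \<open>ge2\<close> lets the empty set
  pay for itself if it occurs.\<close>

lemma sunflower_free_card_recursion:
  fixes d1 d2 :: real
  assumes F: "bounded_family s F" "sunflower_free k F" and s: "s \<ge> 1"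
    and d1: "d1 \<ge> 0" "\<And>v. real (card {U \<in> F. {v} \<subseteq> U}) \<le> d1"
    and d2: "d2 \<ge> 0" "\<And>v w. v \<noteq> w \<Longrightarrow> real (card {U \<in> F. {v, w} \<subseteq> U}) \<le> d2"
    and ge2: "2 \<le> (real s + 1) * d1 + (real s - 1)\<^sup>2 * d2"
  shows "2 * real (card F) \<le> (real k - 1) * ((real s + 1) * d1 + (real s - 1)\<^sup>2 * d2)"
proof -
  let ?K = "(real s + 1) * d1 + (real s - 1)\<^sup>2 * d2"
  have fin: "finite F" and Fs: "\<And>U. U \<in> F \<Longrightarrow> finite U \<and> card U \<le> s"
    using F(1) unfolding bounded_family_def card_at_most_def by auto
  obtain B where B: "B \<subseteq> F" "pairwise disjnt B"
    and max: "\<And>C. C \<subseteq> F \<Longrightarrow> pairwise disjnt C \<Longrightarrow> card C \<le> card B"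
    using ex_maximum_disjoint_subfamily[OF fin] by blast
  have finB: "finite B" using B fin finite_subset by blast
  have meets: "\<exists>W\<in>B. U \<inter> W \<noteq> {}" if "U \<in> F" "U \<notin> B" for U
  proof (rule ccontr)
    assume "\<not> ?thesis"
    then have "pairwise disjnt (insert U B)"
      using B(2) by (auto simp: pairwise_insert disjnt_def)
    from max[OF _ this] show False using that B finB by simp
  qed
  define V where "V = \<Union>B"
  define F' where "F' = F - {{}}"
  define B' where "B' = B - {{}}"
  define e where "e = (if {} \<in> F then 1 else 0 :: nat)"
  \<comment> \<open>The empty set meets nothing, so maximality puts it into \<open>B\<close>
    whenever it is in \<open>F\<close>. It thus adds the same \<open>e\<close> to both
    cardinalities.\<close>
  have "{} \<in> F \<longleftrightarrow> {} \<in> B" using meets[of "{}"] B by blast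
  then have cards: "card F = e + card F'" "card B = e + card B'"
    using fin finB card_Suc_Diff1[of F "{}"] card_Suc_Diff1[of B "{}"]
    by (simp_all add: e_def F'_def B'_def)
  have finB': "finite B'" and finF': "finite F'" and B'F: "B' \<subseteq> F"
    using finB fin B by (auto simp: B'_def F'_def)
  have V: "V = \<Union>B'" by (auto simp: V_def B'_def)
  have finV: "finite V" using finB' B'F Fs by (auto simp: V)
  have "card V \<le> (\<Sum>A\<in>B'. card A)"
    unfolding V by (rule card_Union_le_sum_card)
  also have "\<dots> \<le> (\<Sum>A\<in>B'. s)" using Fs B'F by (intro sum_mono) blast
  finally have cardV: "real (card V) \<le> real (card B') * real s"
    by (simp flip: of_nat_mult)
  define S where "S = (\<lambda>A. {U \<in> F. \<exists>v\<in>A. U \<inter> V = {v}})"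
  define S1 where "S1 = {U \<in> F'. card (U \<inter> V) = 1}"
  have S_le: "real (card (S A)) \<le> d1 + (real s - 1)\<^sup>2 * d2" if "A \<in> B'" for A
  proof (rule card_intersecting_private_le[OF F(1) s _ d1 d2, where V = V and A = A])
    show "A \<in> F" "A \<subseteq> V" using that B'F V by auto
    show "S A \<subseteq> F" "\<And>U. U \<in> S A \<Longrightarrow> \<exists>v\<in>A. U \<inter> V = {v}" by (auto simp: S_def)
    fix U U' assume "U \<in> S A" "U' \<in> S A"
    then obtain v v' where UU': "U \<in> F" "v \<in> A" "U \<inter> \<Union>B = {v}" "U' \<in> F" "v' \<in> A" "U' \<inter> \<Union>B = {v'}"
      unfolding S_def V_def by blast
    have "A \<in> B" using that by (simp add: B'_def)
    then show "U \<inter> U' \<noteq> {}"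
      by (rule intersecting_private_sets[OF B(1) finB B(2) _ _ UU', rotated]) (rule max)
  qed
  have "S1 \<subseteq> (\<Union>A\<in>B'. S A)"
  proof
    fix U assume "U \<in> S1"
    then obtain v where v: "U \<in> F" "U \<inter> V = {v}"
      by (auto simp: S1_def F'_def card_1_singleton_iff)
    then obtain A where "A \<in> B'" "v \<in> A" using V by blast
    then show "U \<in> (\<Union>A\<in>B'. S A)" using v by (auto simp: S_def)
  qed
  then have "card S1 \<le> card (\<Union>A\<in>B'. S A)"
    using finB' fin by (intro card_mono) (auto simp: S_def)
  also have "\<dots> \<le> (\<Sum>A\<in>B'. card (S A))" by (rule card_UN_le[OF finB'])
  finally have "real (card S1) \<le> (\<Sum>A\<in>B'. real (card (S A)))"
    by (simp flip: of_nat_sum)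
  also have "\<dots> \<le> (\<Sum>A\<in>B'. d1 + (real s - 1)\<^sup>2 * d2)" by (intro sum_mono S_le)
  finally have cardS1: "real (card S1) \<le> real (card B') * (d1 + (real s - 1)\<^sup>2 * d2)" by simp
  \<comment> \<open>Every nonempty set meets \<open>V\<close>; those meeting it only once receive an
    extra unit, so that each set is counted at least twice.\<close>
  have "2 \<le> card (U \<inter> V) + (if card (U \<inter> V) = 1 then 1 else 0)" if "U \<in> F'" for U
  proof -
    have "U \<inter> V \<noteq> {}"
      using that meets[of U] unfolding F'_def V_def by blast
    then have "card (U \<inter> V) \<noteq> 0" using finV by simp
    then show ?thesis by auto
  qed
  then have "(\<Sum>U\<in>F'. 2) \<le> (\<Sum>U\<in>F'. card (U \<inter> V) + (if card (U \<inter> V) = 1 then 1 else 0))"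
    by (rule sum_mono)
  also have "\<dots> = (\<Sum>U\<in>F'. card (U \<inter> V)) + card S1"
    unfolding S1_def sum.distrib using finF' by (simp flip: sum.inter_filter)
  finally have "2 * card F' \<le> (\<Sum>U\<in>F'. card (U \<inter> V)) + card S1" by simp
  then have "2 * real (card F') \<le> real (\<Sum>U\<in>F'. card (U \<inter> V)) + real (card S1)"
    by linarith
  also have "real (\<Sum>U\<in>F'. card (U \<inter> V)) = (\<Sum>v\<in>V. real (card {U \<in> F'. {v} \<subseteq> U}))"
    unfolding sum_card_Int_eq_sum_degree[OF finF' finV] by simp
  also have "\<dots> \<le> (\<Sum>v\<in>V. d1)"
  proof (rule sum_mono)
    fix v
    have "card {U \<in> F'. {v} \<subseteq> U} \<le> card {U \<in> F. {v} \<subseteq> U}"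
      using fin by (intro card_mono) (auto simp: F'_def)
    then show "real (card {U \<in> F'. {v} \<subseteq> U}) \<le> d1" using d1(2)[of v] by linarith
  qed
  also have "\<dots> \<le> real (card B') * real s * d1"
    using mult_right_mono[OF cardV d1(1)] by simp
  finally have "2 * real (card F') \<le> real (card B') * ?K"
    using cardS1 by (simp add: algebra_simps)
  moreover have "2 * real e \<le> real e * ?K" using ge2 by (simp add: e_def)
  ultimately have "2 * real (card F) \<le> real (card B) * ?K"
    using cards by (simp add: algebra_simps)
  also have "\<dots> \<le> (real k - 1) * ?K"
    using card_disjoint_subfamily_less[OF F(2) B] ge2 by (intro mult_right_mono) auto
  finally show ?thesis .
qed

section \<open>Arithmetic of the bound\<close>

definition sunflower_bound :: "nat \<Rightarrow> nat \<Rightarrow> real" where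
  "sunflower_bound k s = (sqrt 10 - 2)\<^sup>2 * (real k / (sqrt 10 - 2)) ^ s * fact s"

text \<open>The constant enters the estimates only as the positive root of c^2 + 4c = 6, together
  with crude bounds.\<close>

lemma sqrt10_minus_2:
  defines "c \<equiv> sqrt 10 - 2"
  shows "1 < c" "c < 2" "c\<^sup>2 = 6 - 4 * c"
proof -
  have "3 < sqrt 10" "sqrt 10 < 4" by (auto intro: real_less_rsqrt real_less_lsqrt)
  then show "1 < c" "c < 2" by (simp_all add: c_def)
  show "c\<^sup>2 = 6 - 4 * c" by (simp add: c_def power2_eq_square algebra_simps)
qed

lemma sunflower_bound_1: "sunflower_bound k 1 = (sqrt 10 - 2) * real k"
  and sunflower_bound_2: "sunflower_bound k 2 = 2 * (real k)\<^sup>2"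
  using sqrt10_minus_2(1) by (simp_all add: sunflower_bound_def power2_eq_square)

text \<open>Supplies hypothesis \<open>ge2\<close> of the recursion in the inductive step. One
  factor \<open>k / c\<close> cancels a \<open>c\<close> of the prefactor, leaving a product of
  factors that are all at least 1.\<close>

lemma sunflower_bound_ge_1:
  assumes "k \<ge> 2" "s \<ge> 1"
  shows "sunflower_bound k s \<ge> 1"
proof -
  define c where "c = sqrt 10 - 2"
  note c = sqrt10_minus_2[folded c_def]
  obtain m where m: "s = Suc m" using assms(2) by (cases s) auto
  have "real k / c \<ge> 1" using c assms(1) by simp
  then have "(real k / c) ^ m \<ge> 1" by (rule one_le_power)
  moreover have "c * real k \<ge> 1" using c assms(1) mult_mono[of 1 c 1 "real k"] by simp
  moreover have "(fact s :: real) \<ge> 1" by (rule fact_ge_1)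
  ultimately have "c * real k * (real k / c) ^ m * fact s \<ge> 1 * 1 * 1"
    by (intro mult_mono) auto
  moreover have "sunflower_bound k s = c * real k * (real k / c) ^ m * fact s"
    using c(1) by (simp add: sunflower_bound_def m power2_eq_square flip: c_def)
  ultimately show ?thesis by simp
qed

text \<open>The right-hand side of the recursion for \<open>s = n + 2\<close>, with the bound
  inserted for both degrees.\<close>

lemma sunflower_bound_recursion:
  assumes k: "k \<ge> 2" and n: "n \<ge> 1"
  shows "(real k - 1) * ((real n + 3) * sunflower_bound k (n + 1) + (real n + 1)\<^sup>2 * sunflower_bound k n)
    < 2 * sunflower_bound k (n + 2)"
proof -
  define c where "c = sqrt 10 - 2"
  note c = sqrt10_minus_2[folded c_def]
  define x where "x = real k"
  define y where "y = real n"
  \<comment> \<open>This is \<open>(k / c) ^ n * fact (n + 1)\<close>, a common factor whose removal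
    leaves a polynomial inequality in \<open>x\<close>, \<open>y\<close> and
    \<open>c\<close>.\<close>
  define q where "q = sunflower_bound k n / c\<^sup>2 * (y + 1)"
  have x: "x \<ge> 2" and y: "y \<ge> 1" using k n by (simp_all add: x_def y_def)
  have q: "q > 0" using c(1) x y by (simp add: q_def sunflower_bound_def x_def flip: c_def)
  \<comment> \<open>After substituting c^2 = 6 - 4c the next inequality reduces to this one.
    Equality holds at \<open>y = 1\<close>, that is \<open>s = 3\<close>, which determines
    \<open>c\<close>.\<close>
  have "c * (y - 1) \<ge> y - 1" using c y mult_right_mono[of 1 c "y - 1"] by simp
  then have "(y + 3) * c + (y + 1) * (c\<^sup>2 / 2) \<le> 2 * (y + 2)"
    unfolding c(3) by (simp add: algebra_simps diff_divide_distrib)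
  then have "(x - 1) * x * ((y + 3) * c + (y + 1) * (c\<^sup>2 / 2)) \<le> (x - 1) * x * (2 * (y + 2))"
    using x by (intro mult_left_mono) auto
  \<comment> \<open>Here \<open>k \<ge> 2\<close> enters: the term in \<open>c\<^sup>2\<close>
    without a factor \<open>x\<close> is bounded by \<open>x / 2\<close> times itself.\<close>
  moreover have "(x - 1) * ((y + 1) * c\<^sup>2 * 2) \<le> (x - 1) * ((y + 1) * c\<^sup>2 * x)"
    using x y by (intro mult_left_mono) auto
  \<comment> \<open>Strictness comes from the gap between \<open>(x - 1) * x\<close> and
    \<open>x\<^sup>2\<close>.\<close>
  moreover have "x * (2 * (y + 2)) > 0" using x y by simp
  ultimately have "(x - 1) * ((y + 3) * (x * c) + (y + 1) * c\<^sup>2) < 2 * (x\<^sup>2 * (y + 2))"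
    by (simp add: algebra_simps power2_eq_square diff_divide_distrib add_divide_distrib)
  then have less: "q * ((x - 1) * ((y + 3) * (x * c) + (y + 1) * c\<^sup>2)) < q * (2 * (x\<^sup>2 * (y + 2)))"
    using q by simp
  have g: "(y + 1) * sunflower_bound k n = q * c\<^sup>2"
    "sunflower_bound k (n + 1) = q * (x * c)"
    "sunflower_bound k (n + 2) = q * (x\<^sup>2 * (y + 2))"
    using c(1) by (simp_all add: q_def sunflower_bound_def x_def y_def power2_eq_square flip: c_def)
      (simp_all add: field_simps)
  have "(real k - 1) * ((real n + 3) * sunflower_bound k (n + 1) + (real n + 1)\<^sup>2 * sunflower_bound k n)
      = (x - 1) * ((y + 3) * sunflower_bound k (n + 1) + (y + 1) * ((y + 1) * sunflower_bound k n))"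
    by (simp add: x_def y_def power2_eq_square)
  also have "\<dots> = q * ((x - 1) * ((y + 3) * (x * c) + (y + 1) * c\<^sup>2))"
    unfolding g by (simp add: algebra_simps)
  finally show ?thesis using less g(3) by simp
qed

section \<open>Base cases and the induction on \<open>s\<close>\<close>

lemma bounded_family_0_card_le:
  assumes "bounded_family 0 F"
  shows "card F \<le> 1"
proof -
  have "F \<subseteq> {{}}" using assms by (auto simp: bounded_family_def card_at_most_def)
  then show ?thesis using card_mono[of "{{}}" F] by simp
qed

lemma sunflower_free_card_le_1:
  assumes F: "bounded_family 1 F" "sunflower_free k F"
  shows "real (card F) \<le> real k - 1"
proof -
  have deg: "real (card {U \<in> F. {v} \<subseteq> U}) \<le> 1" for v
    using F by (rule card_containing_le) (auto dest: bounded_family_0_card_le)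
  have pair: "real (card {U \<in> F. {v, w} \<subseteq> U}) \<le> 1" if "v \<noteq> w" for v w
    using F by (rule card_containing_le) (use that in \<open>auto dest: bounded_family_0_card_le\<close>)
  \<comment> \<open>With \<open>s = 1\<close> and \<open>d1 = 1\<close> the bracket of the recursion
    is exactly 2, as the pair term has coefficient 0.\<close>
  show ?thesis
    using sunflower_free_card_recursion[OF F _ _ deg _ pair] by simp
qed

text \<open>The arithmetic step needs \<open>n \<ge> 1\<close>, so \<open>s = 1\<close> and
  \<open>s = 2\<close> are base cases, settled with the sharper degree bounds \<open>k - 1\<close>
  and 1.\<close>

lemma sunflower_free_card_less:
  assumes k: "k \<ge> 2" and "s \<ge> 1" "bounded_family s F" "sunflower_free k F"
  shows "real (card F) < sunflower_bound k s"
  using assms(2-)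
proof (induction s arbitrary: F rule: less_induct)
  case (less s)
  note F = less.prems(2,3)
  consider "s = 1" | "s = 2" | n where "s = n + 2" "n \<ge> 1"
    using less.prems(1) that(3)[of "s - 2"] that(1,2) by linarith
  then show ?case
  proof cases
    case 1
    have "real k \<le> sunflower_bound k 1"
      unfolding sunflower_bound_1 using sqrt10_minus_2(1) mult_right_mono[of 1 "sqrt 10 - 2" "real k"] by simp
    then show ?thesis using sunflower_free_card_le_1[of F k] F 1 by simp
  next
    case 2
    have deg: "real (card {U \<in> F. {v} \<subseteq> U}) \<le> real k - 1" for v
      using F by (rule card_containing_le) (auto simp: 2 intro: sunflower_free_card_le_1)
    have pair: "real (card {U \<in> F. {v, w} \<subseteq> U}) \<le> 1" if "v \<noteq> w" for v w
      using F by (rule card_containing_le) (use that 2 in \<open>auto dest: bounded_family_0_card_le\<close>)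
    have "2 * real (card F) \<le> (real k - 1) * (3 * (real k - 1) + 1)"
      using sunflower_free_card_recursion[OF F _ _ deg _ pair] k 2 by simp
    also have "\<dots> < 2 * (2 * (real k)\<^sup>2)"
    proof -
      \<comment> \<open>The difference of the two sides is
        \<open>k\<^sup>2 + 5 * k - 2\<close>.\<close>
      have "2 < real k * real k + real k * 5" using k zero_le_square[of "real k"] by linarith
      then show ?thesis by (simp add: power2_eq_square algebra_simps)
    qed
    finally show ?thesis by (simp add: 2 sunflower_bound_2)
  next
    case 3
    have IH: "real (card G) \<le> sunflower_bound k m"
      if "1 \<le> m" "m < s" "bounded_family m G" "sunflower_free k G" for m and G :: "'a set set"
      using less.IH that by force
    have deg: "real (card {U \<in> F. {v} \<subseteq> U}) \<le> sunflower_bound k (n + 1)" for v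
      using F by (rule card_containing_le) (use 3 in \<open>auto intro!: IH\<close>)
    have pair: "real (card {U \<in> F. {v, w} \<subseteq> U}) \<le> sunflower_bound k n" if "v \<noteq> w" for v w
      using F by (rule card_containing_le) (use 3 that in \<open>auto intro!: IH\<close>)
    have ge1: "sunflower_bound k (n + 1) \<ge> 1" "sunflower_bound k n \<ge> 1"
      using k 3 by (auto intro: sunflower_bound_ge_1)
    have "2 * 1 \<le> (real s + 1) * sunflower_bound k (n + 1)"
      using ge1 3 by (intro mult_mono) auto
    then have "2 \<le> (real s + 1) * sunflower_bound k (n + 1) + (real s - 1)\<^sup>2 * sunflower_bound k n"
      using ge1 by (simp add: add_increasing2)
    then have "2 * real (card F) \<le> (real k - 1) *
        ((real s + 1) * sunflower_bound k (n + 1) + (real s - 1)\<^sup>2 * sunflower_bound k n)"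
      using ge1 3 by (intro sunflower_free_card_recursion[OF F _ _ deg _ pair]) auto
    also have "\<dots> = (real k - 1) *
        ((real n + 3) * sunflower_bound k (n + 1) + (real n + 1)\<^sup>2 * sunflower_bound k n)"
      by (simp add: 3 algebra_simps)
    also have "\<dots> < 2 * sunflower_bound k s"
      using sunflower_bound_recursion[OF k] 3 by simp
    finally show ?thesis by simp
  qed
qed

theorem mainTheorem2:
  fixes s k :: nat and X :: "'a set" and F :: "'a set set"
  assumes "s \<ge> 1" and "k \<ge> 1"
    and "F \<subseteq> Pow X"
    and "\<And>U. U \<in> F \<Longrightarrow> card_at_most U s"
    and "card_at_least F ((sqrt 10 - 2)\<^sup>2 * (real k / (sqrt 10 - 2)) ^ s * fact s)"
  shows "\<exists>B. B \<subseteq> F \<and> k_sunflower k B"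
proof -
  \<comment> \<open>The counting needs a finite family; an infinite \<open>F\<close> has finite
    subfamilies of every size.\<close>
  obtain G where G: "G \<subseteq> F" "finite G" "real (card G) \<ge> sunflower_bound k s"
  proof (cases "finite F")
    case True
    then show thesis using that[of F] assms(5) by (simp add: card_at_least_def sunflower_bound_def)
  next
    case False
    obtain G where "G \<subseteq> F" "finite G" "card G = nat \<lceil>sunflower_bound k s\<rceil>"
      using infinite_arbitrarily_large[OF False] by blast
    then show thesis using that real_nat_ceiling_ge by metis
  qed
  have bd: "bounded_family s G" using G assms(4) by (auto simp: bounded_family_def)
  have "\<not> sunflower_free k G"
  \<comment> \<open>For \<open>k = 1\<close> any single member is a sunflower, and positivity of the
    bound provides one.\<close>
  proof (cases "k = 1")
    case True
    have "sunflower_bound k s > 0"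
      using sqrt10_minus_2(1) True by (simp add: sunflower_bound_def)
    then obtain U where "U \<in> G" using G(3) by fastforce
    moreover have "k_sunflower 1 {U}"
      by (simp add: k_sunflower_def sunflower_def sunflower_with_core_def)
    ultimately show ?thesis using True unfolding sunflower_free_def by blast
  next
    case False
    then show ?thesis using sunflower_free_card_less[of k s G] bd assms(1,2) G(3) by fastforce
  qed
  then show ?thesis using G(1) unfolding sunflower_free_def by blast
qed

end
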